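(* Let $R$ be a nonzero unital commutative ring, let $X$ be a Stone space and let $J$ be an ideal of $\operatorname{Lc}(X,R)$. Let $$F=\{x\in X : f(x)=0 \text{ for all } f\in J\},$$ and suppose that for every $x\in X\setminus F$ there is $f\in J$ with $f(x)=1$. Then $\operatorname{Lc}(X,R)/J\cong \operatorname{Lc}(F,R)$ as $R$-algebras.
   Context: A Stone space is a Hausdorff space with a basis of compact-open sets (not necessarily compact). For a Stone space $X$, $\operatorname{Lc}(X,R)$ is the $R$-algebra of locally constant functions $X\to R$ with compact support, with pointwise operations. The set $F$ is closed in $X$ and carries the subspace topology (with which it is a Stone space). *)

theory Defs
  imports
    "HOL-Analysis.T1_Spaces"
    "HOL-Algebra.QuotRing"
    "HOL-Algebra.Module"
begin

definition stone_space :: "'a topology \<Rightarrow> bool" where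
  "stone_space X \<longleftrightarrow>
     Hausdorff_space X \<and>
     (\<exists>\<B>. (\<forall>K\<in>\<B>. openin X K \<and> compactin X K) \<and>
          openin X = arbitrary union_of (\<lambda>K. K \<in> \<B>))"

definition loc_constant :: "'a topology \<Rightarrow> ('a \<Rightarrow> 'r) \<Rightarrow> bool" where
  "loc_constant X f \<longleftrightarrow>
     (\<forall>x\<in>topspace X. \<exists>U. openin X U \<and> x \<in> U \<and> (\<forall>y\<in>U. f y = f x))"

definition compact_support :: "('r, 'm) ring_scheme \<Rightarrow> 'a topology \<Rightarrow> ('a \<Rightarrow> 'r) \<Rightarrow> bool" where
  "compact_support R X f \<longleftrightarrow>
     compactin X (X closure_of {x \<in> topspace X. f x \<noteq> \<zero>\<^bsub>R\<^esub>})"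

text \<open>
  Functions on the space are represented extensionally (with the value \<open>undefined\<close> outside
  \<open>topspace X\<close>). \<open>Lc R X\<close> is in general not unital: the field \<open>one\<close>, which the
  record type forces us to provide, lies in the carrier only if \<open>X\<close> is compact, and nothing
  below depends on it.
\<close>

definition Lc :: "('r, 'm) ring_scheme \<Rightarrow> 'a topology \<Rightarrow> ('r, 'a \<Rightarrow> 'r) module" where
  "Lc R X =
     \<lparr>carrier = {f \<in> topspace X \<rightarrow>\<^sub>E carrier R. loc_constant X f \<and> compact_support R X f},
      mult = (\<lambda>f g. \<lambda>x\<in>topspace X. f x \<otimes>\<^bsub>R\<^esub> g x),
      one = (\<lambda>x\<in>topspace X. \<one>\<^bsub>R\<^esub>),
      zero = (\<lambda>x\<in>topspace X. \<zero>\<^bsub>R\<^esub>),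
      add = (\<lambda>f g. \<lambda>x\<in>topspace X. f x \<oplus>\<^bsub>R\<^esub> g x),
      smult = (\<lambda>r f. \<lambda>x\<in>topspace X. r \<otimes>\<^bsub>R\<^esub> f x)\<rparr>"

text \<open>
  The library's locale \<open>ideal\<close> includes the axioms of a unital ring, so it cannot be used for
  \<open>Lc R X\<close>. Closure under scalars is not demanded: in \<open>Lc R X\<close> over a Stone space it is
  automatic, because \<open>r f = (r 1\<^sub>U) f\<close> for the compact open support \<open>U\<close> of \<open>f\<close>.
\<close>

definition ring_ideal :: "'b set \<Rightarrow> ('b, 'm) ring_scheme \<Rightarrow> bool" where
  "ring_ideal J A \<longleftrightarrow>
     additive_subgroup J A \<and>
     (\<forall>a\<in>J. \<forall>x\<in>carrier A. x \<otimes>\<^bsub>A\<^esub> a \<in> J \<and> a \<otimes>\<^bsub>A\<^esub> x \<in> J)"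

text \<open>
  The ring operations of the quotient are those of the library's \<open>A Quot J\<close>; the scalar
  multiplication, \<open>r (J + a) = J + r a\<close>, is written in the style of \<open>rcoset_mult\<close>.
\<close>

definition quot_alg :: "('r, 'b) module \<Rightarrow> 'b set \<Rightarrow> ('r, 'b set) module" where
  "quot_alg A J =
     \<lparr>carrier = carrier (A Quot J),
      mult = mult (A Quot J),
      one = one (A Quot J),
      zero = zero (A Quot J),
      add = add (A Quot J),
      smult = (\<lambda>r C. \<Union>a\<in>C. J +>\<^bsub>A\<^esub> (r \<odot>\<^bsub>A\<^esub> a))\<rparr>"

text \<open>
  Isomorphisms of not necessarily unital \<open>R\<close>-algebras; a bijection of this kind respects units
  whenever they exist.
\<close>

definition alg_iso :: "('r, 'm) ring_scheme \<Rightarrow> ('r, 'b) module \<Rightarrow> ('r, 'c) module \<Rightarrow> ('b \<Rightarrow> 'c) set"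
  where
  "alg_iso R A B =
     {h. bij_betw h (carrier A) (carrier B) \<and>
         (\<forall>a\<in>carrier A. \<forall>b\<in>carrier A. h (a \<oplus>\<^bsub>A\<^esub> b) = h a \<oplus>\<^bsub>B\<^esub> h b) \<and>
         (\<forall>a\<in>carrier A. \<forall>b\<in>carrier A. h (a \<otimes>\<^bsub>A\<^esub> b) = h a \<otimes>\<^bsub>B\<^esub> h b) \<and>
         (\<forall>r\<in>carrier R. \<forall>a\<in>carrier A. h (r \<odot>\<^bsub>A\<^esub> a) = r \<odot>\<^bsub>B\<^esub> h a)}"

definition alg_isomorphic :: "('r, 'm) ring_scheme \<Rightarrow> ('r, 'b) module \<Rightarrow> ('r, 'c) module \<Rightarrow> bool"
  where
  "alg_isomorphic R A B \<longleftrightarrow> alg_iso R A B \<noteq> {}"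

end

(* Restriction to F is an algebra homomorphism Lc(X,R) -> Lc(F,R), so it suffices to see that its
   kernel is J and that it is onto. If f vanishes on F, its compact support is covered by finitely
   many sets {g = 1} with g in J; peeling off f = f g + f (1 - g) one g at a time puts f in J.
   A function h on F extends because its compact support is covered by finitely many compact open
   subsets of X on whose traces on F it is constant, and these can be made disjoint. *)

theory Submission
  imports Defs
begin

section \<open>Algebras of locally constant functions\<close>

text \<open>A locally constant function is continuous for the discrete topology on its values, so
  every condition \<open>P\<close> on values cuts out an open set. Applied to the negation of
  \<open>P\<close>, this yields closedness as well.\<close>

lemma openin_loc_constant_vimage:
  assumes "loc_constant X f"
  shows "openin X {x \<in> topspace X. P (f x)}"
proof (subst openin_subopen, intro ballI)
  fix x assume x: "x \<in> {x \<in> topspace X. P (f x)}"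
  then obtain U where U: "openin X U" "x \<in> U" "\<forall>y\<in>U. f y = f x"
    using assms unfolding loc_constant_def by blast
  have "U \<subseteq> {x \<in> topspace X. P (f x)}"
  proof
    fix y assume "y \<in> U"
    then have "f y = f x" "y \<in> topspace X" using U(3) openin_subset[OF U(1)] by blast+
    with x show "y \<in> {x \<in> topspace X. P (f x)}" by simp
  qed
  with U show "\<exists>T. openin X T \<and> x \<in> T \<and> T \<subseteq> {x \<in> topspace X. P (f x)}" by blast
qed

lemma closedin_loc_constant_vimage:
  assumes "loc_constant X f"
  shows "closedin X {x \<in> topspace X. P (f x)}"
proof -
  have "topspace X - {x \<in> topspace X. P (f x)} = {x \<in> topspace X. \<not> P (f x)}" by auto
  then show ?thesis
    using openin_loc_constant_vimage[OF assms, of "\<lambda>y. \<not> P y"] by (simp add: closedin_def)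
qed

lemma mem_Lc_iff:
  "f \<in> carrier (Lc R X) \<longleftrightarrow>
     f \<in> topspace X \<rightarrow>\<^sub>E carrier R \<and> loc_constant X f \<and>
     compactin X {x \<in> topspace X. f x \<noteq> \<zero>\<^bsub>R\<^esub>}"
  using closedin_loc_constant_vimage[of X f "\<lambda>y. y \<noteq> \<zero>\<^bsub>R\<^esub>"]
  by (auto simp: Lc_def compact_support_def closure_of_closedin)

lemma Lc_apply_closed:
  "f \<in> carrier (Lc R X) \<Longrightarrow> x \<in> topspace X \<Longrightarrow> f x \<in> carrier R"
  by (auto simp: mem_Lc_iff)

lemma Lc_eqI:
  assumes "f \<in> carrier (Lc R X)" "g \<in> carrier (Lc R X)" "\<And>x. x \<in> topspace X \<Longrightarrow> f x = g x"
  shows "f = g"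
  using assms by (intro extensionalityI[of f "topspace X"]) (auto simp: mem_Lc_iff PiE_def)

text \<open>One argument serves all pointwise operations; unary ones take \<open>g\<close> equal to
  \<open>f\<close>. Since \<open>op\<close> sends two zeros to zero, the new support lies in the
  union of the two old ones.\<close>

lemma Lc_pointwise_closed:
  assumes f: "f \<in> carrier (Lc R X)" and g: "g \<in> carrier (Lc R X)"
    and op: "\<And>a b. a \<in> carrier R \<Longrightarrow> b \<in> carrier R \<Longrightarrow> op a b \<in> carrier R"
    and zero: "op \<zero>\<^bsub>R\<^esub> \<zero>\<^bsub>R\<^esub> = \<zero>\<^bsub>R\<^esub>"
  shows "(\<lambda>x\<in>topspace X. op (f x) (g x)) \<in> carrier (Lc R X)" (is "?h \<in> _")
proof -
  have lc: "loc_constant X ?h"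
    unfolding loc_constant_def
  proof
    fix x assume x: "x \<in> topspace X"
    obtain U V where U: "openin X U" "x \<in> U" "\<forall>y\<in>U. f y = f x"
      and V: "openin X V" "x \<in> V" "\<forall>y\<in>V. g y = g x"
      using f g x unfolding mem_Lc_iff loc_constant_def by meson
    have "openin X (U \<inter> V)" "x \<in> U \<inter> V" using U V by auto
    moreover have "\<forall>y\<in>U \<inter> V. ?h y = ?h x"
    proof
      fix y assume y: "y \<in> U \<inter> V"
      then have "f y = f x" "g y = g x" "y \<in> topspace X"
        using U(3) V(3) openin_subset[OF U(1)] by blast+
      then show "?h y = ?h x" using x by simp
    qed
    ultimately show "\<exists>W. openin X W \<and> x \<in> W \<and> (\<forall>y\<in>W. ?h y = ?h x)" by blast
  qed
  have "compactin X ({x \<in> topspace X. f x \<noteq> \<zero>\<^bsub>R\<^esub>} \<union> {x \<in> topspace X. g x \<noteq> \<zero>\<^bsub>R\<^esub>})"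
    using f g by (intro compactin_Un) (auto simp: mem_Lc_iff)
  moreover have "{x \<in> topspace X. ?h x \<noteq> \<zero>\<^bsub>R\<^esub>} \<subseteq>
      {x \<in> topspace X. f x \<noteq> \<zero>\<^bsub>R\<^esub>} \<union> {x \<in> topspace X. g x \<noteq> \<zero>\<^bsub>R\<^esub>}"
    using zero by auto
  ultimately have "compactin X {x \<in> topspace X. ?h x \<noteq> \<zero>\<^bsub>R\<^esub>}"
    using closedin_loc_constant_vimage[OF lc] by (rule closed_compactin)
  moreover have "?h \<in> topspace X \<rightarrow>\<^sub>E carrier R"
    using op Lc_apply_closed[OF f] Lc_apply_closed[OF g] by (simp add: restrict_PiE_iff)
  ultimately show ?thesis using lc unfolding mem_Lc_iff by blast
qed

text \<open>Openness and closedness of \<open>U\<close> give local constancy at points inside and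
  outside \<open>U\<close>, and compactness of \<open>U\<close> controls the support. Extensions
  from a subspace are built from these functions.\<close>

lemma Lc_indicator_closed:
  assumes "ring R" "c \<in> carrier R" "openin X U" "closedin X U" "compactin X U"
  shows "(\<lambda>x\<in>topspace X. if x \<in> U then c else \<zero>\<^bsub>R\<^esub>) \<in> carrier (Lc R X)" (is "?h \<in> _")
proof -
  interpret ring R by fact
  have lc: "loc_constant X ?h"
    unfolding loc_constant_def
  proof
    fix x assume x: "x \<in> topspace X"
    show "\<exists>W. openin X W \<and> x \<in> W \<and> (\<forall>y\<in>W. ?h y = ?h x)"
    proof (cases "x \<in> U")
      case True
      then show ?thesis using assms(3) openin_subset by (intro exI[of _ U]) auto
    next
      case False
      then show ?thesis
        using x assms(4) by (intro exI[of _ "topspace X - U"]) (auto simp: closedin_def)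
    qed
  qed
  moreover have "compactin X {x \<in> topspace X. ?h x \<noteq> \<zero>\<^bsub>R\<^esub>}"
    by (rule closed_compactin[OF assms(5) _ closedin_loc_constant_vimage[OF lc]])
      (auto split: if_splits)
  ultimately show ?thesis using assms(2) by (auto simp: mem_Lc_iff)
qed

lemma Lc_simps:
  "f \<oplus>\<^bsub>Lc R X\<^esub> g = (\<lambda>x\<in>topspace X. f x \<oplus>\<^bsub>R\<^esub> g x)"
  "f \<otimes>\<^bsub>Lc R X\<^esub> g = (\<lambda>x\<in>topspace X. f x \<otimes>\<^bsub>R\<^esub> g x)"
  "r \<odot>\<^bsub>Lc R X\<^esub> f = (\<lambda>x\<in>topspace X. r \<otimes>\<^bsub>R\<^esub> f x)"
  "\<zero>\<^bsub>Lc R X\<^esub> = (\<lambda>x\<in>topspace X. \<zero>\<^bsub>R\<^esub>)"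
  by (simp_all add: Lc_def)

lemma Lc_zero_closed:
  assumes "ring R"
  shows "\<zero>\<^bsub>Lc R X\<^esub> \<in> carrier (Lc R X)"
  using Lc_indicator_closed[OF assms ring.ring_simprules(2)[OF assms], of X "{}"]
  by (simp add: Lc_simps)

lemma Lc_closed:
  assumes "ring R" "f \<in> carrier (Lc R X)"
  shows "g \<in> carrier (Lc R X) \<Longrightarrow> f \<oplus>\<^bsub>Lc R X\<^esub> g \<in> carrier (Lc R X)"
    and "g \<in> carrier (Lc R X) \<Longrightarrow> f \<otimes>\<^bsub>Lc R X\<^esub> g \<in> carrier (Lc R X)"
    and "r \<in> carrier R \<Longrightarrow> r \<odot>\<^bsub>Lc R X\<^esub> f \<in> carrier (Lc R X)"
proof -
  interpret ring R by fact
  note f = assms(2)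
  show "f \<oplus>\<^bsub>Lc R X\<^esub> g \<in> carrier (Lc R X)" if "g \<in> carrier (Lc R X)"
    unfolding Lc_simps using f that by (rule Lc_pointwise_closed) auto
  show "f \<otimes>\<^bsub>Lc R X\<^esub> g \<in> carrier (Lc R X)" if "g \<in> carrier (Lc R X)"
    unfolding Lc_simps using f that by (rule Lc_pointwise_closed) auto
  show "r \<odot>\<^bsub>Lc R X\<^esub> f \<in> carrier (Lc R X)" if "r \<in> carrier R"
    unfolding Lc_simps by (rule Lc_pointwise_closed[OF f f]) (use that in auto)
qed

text \<open>\<open>Lc R X\<close> need not contain a unit, so it is treated as an abelian group,
  which is enough for coset arithmetic; closure under products is supplied separately.\<close>

lemma abelian_group_Lc:
  assumes "ring R"
  shows "abelian_group (Lc R X)"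
proof -
  interpret ring R by fact
  note cl = Lc_apply_closed[of _ R X]
  show ?thesis
  proof (rule abelian_groupI)
    show zero: "\<zero>\<^bsub>Lc R X\<^esub> \<in> carrier (Lc R X)" by (rule Lc_zero_closed[OF assms])
    fix f assume f: "f \<in> carrier (Lc R X)"
    have "(\<lambda>x\<in>topspace X. \<ominus>\<^bsub>R\<^esub> f x) \<in> carrier (Lc R X)"
      using f f by (rule Lc_pointwise_closed) auto
    moreover have "(\<lambda>x\<in>topspace X. \<ominus>\<^bsub>R\<^esub> f x) \<oplus>\<^bsub>Lc R X\<^esub> f = \<zero>\<^bsub>Lc R X\<^esub>"
      by (auto simp: Lc_simps l_neg cl[OF f] intro!: restrict_ext)
    ultimately show "\<exists>g\<in>carrier (Lc R X). g \<oplus>\<^bsub>Lc R X\<^esub> f = \<zero>\<^bsub>Lc R X\<^esub>" by blast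
    show "\<zero>\<^bsub>Lc R X\<^esub> \<oplus>\<^bsub>Lc R X\<^esub> f = f"
      using cl[OF f] by (intro Lc_eqI[OF Lc_closed(1)[OF assms zero f] f]) (simp add: Lc_simps)
  next
    fix f g assume f: "f \<in> carrier (Lc R X)" and g: "g \<in> carrier (Lc R X)"
    then show "f \<oplus>\<^bsub>Lc R X\<^esub> g \<in> carrier (Lc R X)" by (rule Lc_closed(1)[OF assms])
    show "f \<oplus>\<^bsub>Lc R X\<^esub> g = g \<oplus>\<^bsub>Lc R X\<^esub> f"
      unfolding Lc_simps using cl[OF f] cl[OF g] by (intro restrict_ext a_comm)
    fix h assume h: "h \<in> carrier (Lc R X)"
    show "f \<oplus>\<^bsub>Lc R X\<^esub> g \<oplus>\<^bsub>Lc R X\<^esub> h = f \<oplus>\<^bsub>Lc R X\<^esub> (g \<oplus>\<^bsub>Lc R X\<^esub> h)"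
      unfolding Lc_simps using cl[OF f] cl[OF g] cl[OF h]
      by (intro restrict_ext) (simp add: a_assoc)
  qed
qed

section \<open>The isomorphism theorem\<close>

text \<open>The first isomorphism theorem for algebras that need not have a unit. As
  \<open>J\<close> is the kernel of \<open>p\<close>, its cosets are the fibres of \<open>p\<close>,
  and equality of cosets becomes equality of values of \<open>p\<close>.\<close>

lemma alg_isomorphic_quot_alg:
  fixes R :: "('r, 'm) ring_scheme" and A :: "('r, 'b) module" and B :: "('r, 'c) module"
  assumes A: "abelian_group A" and B: "abelian_group B" and J: "additive_subgroup J A"
    and mult: "\<And>a b. a \<in> carrier A \<Longrightarrow> b \<in> carrier A \<Longrightarrow> a \<otimes>\<^bsub>A\<^esub> b \<in> carrier A"
    and smult: "\<And>r a. r \<in> carrier R \<Longrightarrow> a \<in> carrier A \<Longrightarrow> r \<odot>\<^bsub>A\<^esub> a \<in> carrier A"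
    and onto: "p ` carrier A = carrier B"
    and p_add: "\<And>a b. a \<in> carrier A \<Longrightarrow> b \<in> carrier A \<Longrightarrow> p (a \<oplus>\<^bsub>A\<^esub> b) = p a \<oplus>\<^bsub>B\<^esub> p b"
    and p_mult: "\<And>a b. a \<in> carrier A \<Longrightarrow> b \<in> carrier A \<Longrightarrow> p (a \<otimes>\<^bsub>A\<^esub> b) = p a \<otimes>\<^bsub>B\<^esub> p b"
    and p_smult: "\<And>r a. r \<in> carrier R \<Longrightarrow> a \<in> carrier A \<Longrightarrow> p (r \<odot>\<^bsub>A\<^esub> a) = r \<odot>\<^bsub>B\<^esub> p a"
    and ker: "\<And>a. a \<in> carrier A \<Longrightarrow> a \<in> J \<longleftrightarrow> p a = \<zero>\<^bsub>B\<^esub>"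
  shows "alg_isomorphic R (quot_alg A J) B"
proof -
  interpret A: abelian_group A by fact
  interpret B: abelian_group B by fact
  interpret J: abelian_subgroup J A by (rule abelian_subgroupI3[OF J A])
  have pc: "p a \<in> carrier B" if "a \<in> carrier A" for a using onto that by blast
  have coset: "J +>\<^bsub>A\<^esub> a = {b \<in> carrier A. p b = p a}" if a: "a \<in> carrier A" for a
  proof (intro Set.set_eqI iffI)
    fix b assume "b \<in> J +>\<^bsub>A\<^esub> a"
    then obtain j where "j \<in> J" "b = j \<oplus>\<^bsub>A\<^esub> a" by (auto simp: a_r_coset_def')
    then show "b \<in> {b \<in> carrier A. p b = p a}"
      using a J.a_subset ker[of j] pc by (auto simp: p_add)
  next
    fix b assume b: "b \<in> {b \<in> carrier A. p b = p a}"
    define j where "j = b \<ominus>\<^bsub>A\<^esub> a"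
    have j: "j \<in> carrier A" and ja: "j \<oplus>\<^bsub>A\<^esub> a = b"
      using a b by (auto simp: j_def A.minus_eq A.a_assoc A.l_neg)
    then have "p j \<oplus>\<^bsub>B\<^esub> p a = \<zero>\<^bsub>B\<^esub> \<oplus>\<^bsub>B\<^esub> p a" using a b p_add[OF j a] pc by simp
    \<comment> \<open>Keeping the zero summand explicit allows \<open>p a\<close> to be cancelled on
      the right.\<close>
    then have "j \<in> J" using ker[OF j] j a pc by (simp add: B.add.right_cancel del: B.l_zero)
    with ja show "b \<in> J +>\<^bsub>A\<^esub> a" by (auto simp: a_r_coset_def')
  qed
  \<comment> \<open>\<open>p\<close> is constant on each coset, so the image is a singleton and no
    representative has to be chosen.\<close>
  define h where "h C = the_elem (p ` C)" for C
  have h: "h (J +>\<^bsub>A\<^esub> a) = p a" if a: "a \<in> carrier A" for a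
  proof -
    have "p ` (J +>\<^bsub>A\<^esub> a) = {p a}" using a by (auto simp: coset)
    then show ?thesis by (simp add: h_def)
  qed
  have car: "carrier (quot_alg A J) = (\<lambda>a. J +>\<^bsub>A\<^esub> a) ` carrier A"
    by (auto simp: quot_alg_def FactRing_def A_RCOSETS_def')
  have add: "(J +>\<^bsub>A\<^esub> a) \<oplus>\<^bsub>quot_alg A J\<^esub> (J +>\<^bsub>A\<^esub> b) = J +>\<^bsub>A\<^esub> (a \<oplus>\<^bsub>A\<^esub> b)"
    if "a \<in> carrier A" "b \<in> carrier A" for a b
    using that by (simp add: quot_alg_def FactRing_def J.a_rcos_sum)
  have mul: "(J +>\<^bsub>A\<^esub> a) \<otimes>\<^bsub>quot_alg A J\<^esub> (J +>\<^bsub>A\<^esub> b) = J +>\<^bsub>A\<^esub> (a \<otimes>\<^bsub>A\<^esub> b)"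
    if "a \<in> carrier A" "b \<in> carrier A" for a b
  proof -
    have "(J +>\<^bsub>A\<^esub> a) \<otimes>\<^bsub>quot_alg A J\<^esub> (J +>\<^bsub>A\<^esub> b) =
        (\<Union>a'\<in>J +>\<^bsub>A\<^esub> a. \<Union>b'\<in>J +>\<^bsub>A\<^esub> b. J +>\<^bsub>A\<^esub> (a' \<otimes>\<^bsub>A\<^esub> b'))"
      by (simp add: quot_alg_def FactRing_def rcoset_mult_def)
    \<comment> \<open>All products \<open>a' \<otimes> b'\<close> of representatives have the same
      image under \<open>p\<close>, so every coset in this nonempty union is the same one.\<close>
    also have "\<dots> = J +>\<^bsub>A\<^esub> (a \<otimes>\<^bsub>A\<^esub> b)"
      using that by (auto simp: coset mult p_mult)
    finally show ?thesis .
  qed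
  have smul: "r \<odot>\<^bsub>quot_alg A J\<^esub> (J +>\<^bsub>A\<^esub> a) = J +>\<^bsub>A\<^esub> (r \<odot>\<^bsub>A\<^esub> a)"
    if "r \<in> carrier R" "a \<in> carrier A" for r a
  proof -
    have "r \<odot>\<^bsub>quot_alg A J\<^esub> (J +>\<^bsub>A\<^esub> a) = (\<Union>a'\<in>J +>\<^bsub>A\<^esub> a. J +>\<^bsub>A\<^esub> (r \<odot>\<^bsub>A\<^esub> a'))"
      by (simp add: quot_alg_def)
    also have "\<dots> = J +>\<^bsub>A\<^esub> (r \<odot>\<^bsub>A\<^esub> a)"
      using that by (auto simp: coset smult p_smult)
    finally show ?thesis .
  qed
  have "inj_on h (carrier (quot_alg A J))"
    unfolding car by (auto intro!: inj_onI simp: h) (auto simp: coset)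
  moreover have "h ` carrier (quot_alg A J) = carrier B"
    unfolding car image_image using onto h by (metis image_cong)
  ultimately have "bij_betw h (carrier (quot_alg A J)) (carrier B)"
    by (simp add: bij_betw_def)
  then have "h \<in> alg_iso R (quot_alg A J) B"
    unfolding alg_iso_def car
    by (auto simp: add mul smul h mult smult p_add p_mult p_smult)
  then show ?thesis by (auto simp: alg_isomorphic_def)
qed

section \<open>Restriction to a closed subset\<close>

text \<open>Closedness of \<open>F\<close> is what makes the trace of the compact support on
  \<open>F\<close> compact again.\<close>

lemma Lc_restrict_closed:
  assumes f: "f \<in> carrier (Lc R X)" and F: "closedin X F"
  shows "restrict f F \<in> carrier (Lc R (subtopology X F))"
proof -
  have FX: "F \<subseteq> topspace X" using F closedin_subset by blast
  then have top: "topspace (subtopology X F) = F" by auto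
  have "loc_constant (subtopology X F) (restrict f F)"
    unfolding loc_constant_def top
  proof
    fix x assume x: "x \<in> F"
    then obtain U where U: "openin X U" "x \<in> U" "\<forall>y\<in>U. f y = f x"
      using f FX unfolding mem_Lc_iff loc_constant_def by (meson subsetD)
    have "restrict f F y = restrict f F x" if "y \<in> U \<inter> F" for y
    proof -
      have "f y = f x" using U(3) that by blast
      then show ?thesis using x that by simp
    qed
    moreover have "openin (subtopology X F) (U \<inter> F)"
      using U(1) by (auto simp: openin_subtopology)
    ultimately show "\<exists>U. openin (subtopology X F) U \<and> x \<in> U \<and>
        (\<forall>y\<in>U. restrict f F y = restrict f F x)"
      using x U(2) by blast
  qed
  moreover have "compactin X (F \<inter> {x \<in> topspace X. f x \<noteq> \<zero>\<^bsub>R\<^esub>})"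
    using f F by (intro closed_Int_compactin) (auto simp: mem_Lc_iff)
  moreover have "F \<inter> {x \<in> topspace X. f x \<noteq> \<zero>\<^bsub>R\<^esub>} = {x \<in> F. restrict f F x \<noteq> \<zero>\<^bsub>R\<^esub>}"
    using FX by auto
  ultimately show ?thesis
    using f FX unfolding mem_Lc_iff top by (auto simp: compactin_subtopology)
qed

text \<open>Basis members are compact and open; the Hausdorff property makes them closed
  too.\<close>

lemma stone_space_compact_open_nbhd:
  assumes "stone_space X" "openin X W" "x \<in> W"
  obtains V where "openin X V" "closedin X V" "compactin X V" "x \<in> V" "V \<subseteq> W"
proof -
  obtain \<B> where \<B>: "\<forall>K\<in>\<B>. openin X K \<and> compactin X K"
    "openin X = arbitrary union_of (\<lambda>K. K \<in> \<B>)" and "Hausdorff_space X"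
    using assms(1) unfolding stone_space_def by blast
  then have "(arbitrary union_of (\<lambda>K. K \<in> \<B>)) W" using assms(2) by simp
  then obtain V where "V \<in> \<B>" "x \<in> V" "V \<subseteq> W"
    using assms(3) by (auto simp: union_of_def arbitrary_def)
  with \<B> \<open>Hausdorff_space X\<close> that show ?thesis
    using compactin_imp_closedin by metis
qed

text \<open>Induction on the cover: a new member contributes its constant only on the part not yet
  covered. Requiring \<open>f\<close> to vanish off the cover lets this contribution simply be
  added.\<close>

lemma Lc_extension_finite_cover:
  assumes R: "ring R" and F: "F \<subseteq> topspace X" and h: "h \<in> F \<rightarrow> carrier R"
    and "finite \<V>"
    and "\<And>V. V \<in> \<V> \<Longrightarrow> openin X V \<and> closedin X V \<and> compactin X V \<and>
            (\<exists>c\<in>carrier R. \<forall>y\<in>V \<inter> F. h y = c)"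
  shows "\<exists>f\<in>carrier (Lc R X). \<forall>x\<in>topspace X.
           (x \<notin> \<Union>\<V> \<longrightarrow> f x = \<zero>\<^bsub>R\<^esub>) \<and> (x \<in> F \<inter> \<Union>\<V> \<longrightarrow> f x = h x)"
  using assms(4,5)
proof (induction \<V>)
  case empty
  show ?case
    using Lc_zero_closed[OF R, of X] by (intro bexI[of _ "\<zero>\<^bsub>Lc R X\<^esub>"]) (auto simp: Lc_simps)
next
  case (insert V \<V>)
  interpret ring R by fact
  from insert obtain f where f: "f \<in> carrier (Lc R X)"
    "\<And>x. x \<in> topspace X \<Longrightarrow> x \<notin> \<Union>\<V> \<Longrightarrow> f x = \<zero>\<^bsub>R\<^esub>"
    "\<And>x. x \<in> topspace X \<Longrightarrow> x \<in> F \<Longrightarrow> x \<in> \<Union>\<V> \<Longrightarrow> f x = h x" by auto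
  from insert.prems obtain c where V: "openin X V" "closedin X V" "compactin X V"
    and c: "c \<in> carrier R" "\<And>y. y \<in> V \<Longrightarrow> y \<in> F \<Longrightarrow> h y = c"
    by (meson IntI insertI1)
  \<comment> \<open>Subtracting the earlier members makes the pieces disjoint. A difference of
    clopen sets is clopen, and \<open>D\<close> is compact as a closed subset of
    \<open>V\<close>.\<close>
  define D where "D = V - \<Union>\<V>"
  have U: "openin X (\<Union>\<V>)" "closedin X (\<Union>\<V>)"
    using insert.prems insert.hyps by (auto intro!: closedin_Union)
  have D: "openin X D" "closedin X D" "compactin X D"
    using U V closed_compactin[OF V(3), of D] by (auto simp: D_def openin_diff closedin_diff)
  let ?e = "\<lambda>x\<in>topspace X. if x \<in> D then c else \<zero>\<^bsub>R\<^esub>"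
  have "f \<oplus>\<^bsub>Lc R X\<^esub> ?e \<in> carrier (Lc R X)"
    by (rule Lc_closed(1)[OF R f(1) Lc_indicator_closed[OF R c(1) D]])
  \<comment> \<open>On \<open>D\<close> the old \<open>f\<close> is zero, so the sum takes the value
    \<open>c\<close> there and is unchanged elsewhere.\<close>
  moreover have "(f \<oplus>\<^bsub>Lc R X\<^esub> ?e) x = (if x \<in> D then c else f x)" if "x \<in> topspace X" for x
    using that f(2)[OF that] Lc_apply_closed[OF f(1) that] c(1) by (auto simp: Lc_simps D_def)
  ultimately show ?case
    using f(2,3) c(2) by (intro bexI[of _ "f \<oplus>\<^bsub>Lc R X\<^esub> ?e"]) (auto simp: D_def)
qed

text \<open>Compactness of the support of \<open>h\<close> reduces the extension problem to a finite
  cover by compact open sets of the whole space.\<close>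

lemma Lc_restrict_surj:
  assumes R: "ring R" and X: "stone_space X" and F: "F \<subseteq> topspace X"
    and h: "h \<in> carrier (Lc R (subtopology X F))"
  obtains f where "f \<in> carrier (Lc R X)" "\<And>x. x \<in> F \<Longrightarrow> f x = h x"
proof -
  have top: "topspace (subtopology X F) = F" using F by auto
  have hc: "h \<in> F \<rightarrow> carrier R" using h unfolding mem_Lc_iff top by auto
  define K where "K = {x \<in> F. h x \<noteq> \<zero>\<^bsub>R\<^esub>}"
  have K: "compactin X K"
    using h unfolding mem_Lc_iff top K_def by (auto simp: compactin_subtopology)
  define \<U> where "\<U> = {V. openin X V \<and> closedin X V \<and> compactin X V \<and>
    (\<exists>c\<in>carrier R. \<forall>y\<in>V \<inter> F. h y = c)}"
  have "K \<subseteq> \<Union>\<U>"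
  proof
    fix x assume "x \<in> K"
    then have x: "x \<in> F" by (simp add: K_def)
    then obtain W where W: "openin (subtopology X F) W" "x \<in> W" "\<forall>y\<in>W. h y = h x"
      using h unfolding mem_Lc_iff loc_constant_def top by blast
    then obtain W' where W': "openin X W'" "W = W' \<inter> F" by (auto simp: openin_subtopology)
    \<comment> \<open>A neighbourhood on which \<open>h\<close> is constant is only open in
      \<open>F\<close>. It is the trace of an open \<open>W'\<close> of \<open>X\<close>, and
      shrinking \<open>W'\<close> to a compact open \<open>V\<close> keeps \<open>h\<close> constant
      on the trace of \<open>V\<close>.\<close>
    then obtain V where "openin X V" "closedin X V" "compactin X V" "x \<in> V" "V \<subseteq> W'"
      using stone_space_compact_open_nbhd[OF X W'(1)] W(2) by auto
    moreover from this have "\<forall>y\<in>V \<inter> F. h y = h x" using W(3) W'(2) by blast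
    moreover have "h x \<in> carrier R" using hc x by blast
    ultimately show "x \<in> \<Union>\<U>" unfolding \<U>_def by blast
  qed
  then obtain \<V> where \<V>: "finite \<V>" "\<V> \<subseteq> \<U>" "K \<subseteq> \<Union>\<V>"
    using K unfolding compactin_def by (metis (no_types, lifting) \<U>_def mem_Collect_eq)
  obtain f where f: "f \<in> carrier (Lc R X)"
    "\<forall>x\<in>topspace X. (x \<notin> \<Union>\<V> \<longrightarrow> f x = \<zero>\<^bsub>R\<^esub>) \<and> (x \<in> F \<inter> \<Union>\<V> \<longrightarrow> f x = h x)"
    using Lc_extension_finite_cover[OF R F hc \<V>(1)] \<V>(2) unfolding \<U>_def by blast
  moreover have "f x = h x" if x: "x \<in> F" for x
  proof (cases "x \<in> \<Union>\<V>")
    case True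
    then show ?thesis using f(2) x F by auto
  next
    case False
    \<comment> \<open>The cover contains the support of \<open>h\<close>, so outside it both
      \<open>h\<close> and the extension vanish.\<close>
    then have "h x = \<zero>\<^bsub>R\<^esub>" using \<V>(3) x by (auto simp: K_def)
    with False show ?thesis using f(2) x F by auto
  qed
  ultimately show ?thesis using that by blast
qed

section \<open>Ideals of locally constant functions\<close>

text \<open>Split \<open>f\<close> as \<open>f g\<close> plus a remainder. The product lies in the
  ideal, and the remainder vanishes wherever \<open>f\<close> is zero or \<open>g\<close> is one, so
  the other members of \<open>G\<close> suffice for it. The induction therefore has to let
  \<open>f\<close> vary.\<close>

lemma Lc_ideal_mem_finite_cover:
  assumes R: "cring R" and J: "ring_ideal J (Lc R X)" and "finite G" "G \<subseteq> J"
    and "f \<in> carrier (Lc R X)"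
    and "\<And>x. x \<in> topspace X \<Longrightarrow> f x \<noteq> \<zero>\<^bsub>R\<^esub> \<Longrightarrow> \<exists>g\<in>G. g x = \<one>\<^bsub>R\<^esub>"
  shows "f \<in> J"
  using assms(3-6)
proof (induction G arbitrary: f)
  case empty
  interpret cring R by fact
  have "f = \<zero>\<^bsub>Lc R X\<^esub>"
    using empty
    by (intro Lc_eqI[OF empty(2) Lc_zero_closed[OF ring_axioms]]) (auto simp: Lc_simps)
  then show ?case
    using J additive_subgroup.zero_closed unfolding ring_ideal_def by metis
next
  case (insert g G)
  interpret cring R by fact
  have gJ: "g \<in> J" and g: "g \<in> carrier (Lc R X)"
    using insert.prems(1) J additive_subgroup.a_subset unfolding ring_ideal_def by blast+
  note f = insert.prems(2)
  note cl = Lc_apply_closed[OF f] Lc_apply_closed[OF g]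
  \<comment> \<open>This is \<open>f (1 - g)\<close>, expanded because the constant one need not
    have compact support.\<close>
  let ?k = "\<lambda>x\<in>topspace X. f x \<ominus>\<^bsub>R\<^esub> f x \<otimes>\<^bsub>R\<^esub> g x"
  have k: "?k \<in> carrier (Lc R X)"
    using f g by (rule Lc_pointwise_closed) (auto simp: minus_eq)
  have "?k \<in> J"
  proof (rule insert.IH[OF _ k])
    fix x assume x: "x \<in> topspace X" "?k x \<noteq> \<zero>\<^bsub>R\<^esub>"
    then have "g x \<noteq> \<one>\<^bsub>R\<^esub>" "f x \<noteq> \<zero>\<^bsub>R\<^esub>"
      using cl[OF x(1)] by (auto simp: minus_eq r_neg)
    then show "\<exists>g\<in>G. g x = \<one>\<^bsub>R\<^esub>" using insert.prems(3)[OF x(1)] by auto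
  qed (use insert.prems in auto)
  moreover have "f \<otimes>\<^bsub>Lc R X\<^esub> g \<in> J" using gJ f J unfolding ring_ideal_def by blast
  ultimately have "?k \<oplus>\<^bsub>Lc R X\<^esub> (f \<otimes>\<^bsub>Lc R X\<^esub> g) \<in> J"
    using J additive_subgroup.a_closed unfolding ring_ideal_def by metis
  moreover have "?k \<oplus>\<^bsub>Lc R X\<^esub> (f \<otimes>\<^bsub>Lc R X\<^esub> g) = f"
    using cl
    by (intro Lc_eqI[OF Lc_closed(1)[OF ring_axioms k Lc_closed(2)[OF ring_axioms f g]] f])
      (simp add: Lc_simps minus_eq a_assoc l_neg)
  ultimately show ?case by simp
qed

text \<open>This identifies the kernel of restriction to \<open>F\<close> with \<open>J\<close>. If
  \<open>f\<close> vanishes on \<open>F\<close>, its support avoids \<open>F\<close>, so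
  \<open>sep\<close> covers it by the open sets on which some member of \<open>J\<close> is one;
  compactness leaves finitely many.\<close>

lemma Lc_ideal_mem_iff:
  assumes R: "cring R" and J: "ring_ideal J (Lc R X)"
    and F: "F = {x \<in> topspace X. \<forall>f\<in>J. f x = \<zero>\<^bsub>R\<^esub>}"
    and sep: "\<forall>x \<in> topspace X - F. \<exists>f\<in>J. f x = \<one>\<^bsub>R\<^esub>"
    and f: "f \<in> carrier (Lc R X)"
  shows "f \<in> J \<longleftrightarrow> (\<forall>x\<in>F. f x = \<zero>\<^bsub>R\<^esub>)"
proof
  assume 0: "\<forall>x\<in>F. f x = \<zero>\<^bsub>R\<^esub>"
  define K where "K = {x \<in> topspace X. f x \<noteq> \<zero>\<^bsub>R\<^esub>}"
  define U where "U g = {x \<in> topspace X. g x = \<one>\<^bsub>R\<^esub>}" for g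
  have JL: "J \<subseteq> carrier (Lc R X)"
    using J additive_subgroup.a_subset unfolding ring_ideal_def by blast
  have "compactin X K" using f by (simp add: mem_Lc_iff K_def)
  moreover have "\<forall>V\<in>U ` J. openin X V"
    using JL openin_loc_constant_vimage by (fastforce simp: U_def mem_Lc_iff)
  moreover have "K \<subseteq> \<Union>(U ` J)" using 0 sep by (auto simp: K_def U_def)
  ultimately obtain \<V> where \<V>: "finite \<V>" "\<V> \<subseteq> U ` J" "K \<subseteq> \<Union>\<V>"
    unfolding compactin_def by metis
  \<comment> \<open>Choosing one function for each set of the subcover turns it into a finite subset
    of \<open>J\<close>.\<close>
  then obtain G where G: "G \<subseteq> J" "finite G" "\<V> = U ` G" by (meson finite_subset_image)
  show "f \<in> J"
    using \<V>(3) unfolding G(3)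
    by (intro Lc_ideal_mem_finite_cover[OF R J G(2,1) f]) (auto simp: K_def U_def)
qed (auto simp: F)

text \<open>The complement is a union of nonvanishing sets, each open by local constancy.\<close>

lemma closedin_common_zeros:
  assumes "J \<subseteq> carrier (Lc R X)"
  shows "closedin X {x \<in> topspace X. \<forall>f\<in>J. f x = \<zero>\<^bsub>R\<^esub>}"
proof -
  have "{x \<in> topspace X. \<forall>f\<in>J. f x = \<zero>\<^bsub>R\<^esub>} =
      topspace X - (\<Union>f\<in>J. {x \<in> topspace X. f x \<noteq> \<zero>\<^bsub>R\<^esub>})" by auto
  moreover have "openin X (\<Union>f\<in>J. {x \<in> topspace X. f x \<noteq> \<zero>\<^bsub>R\<^esub>})"
  proof (intro openin_Union, clarify)
    fix f assume "f \<in> J"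
    then show "openin X {x \<in> topspace X. f x \<noteq> \<zero>\<^bsub>R\<^esub>}"
      using assms by (intro openin_loc_constant_vimage) (auto simp: mem_Lc_iff)
  qed
  ultimately show ?thesis by auto
qed

theorem proposition3p4:
  fixes R :: "('r, 'm) ring_scheme" and X :: "'a topology"
    and J :: "('a \<Rightarrow> 'r) set" and F :: "'a set"
  assumes "cring R" and "\<one>\<^bsub>R\<^esub> \<noteq> \<zero>\<^bsub>R\<^esub>"
    and "stone_space X"
    and "ring_ideal J (Lc R X)"
    and "F = {x \<in> topspace X. \<forall>f\<in>J. f x = \<zero>\<^bsub>R\<^esub>}"
    and "\<forall>x \<in> topspace X - F. \<exists>f\<in>J. f x = \<one>\<^bsub>R\<^esub>"
  shows "alg_isomorphic R (quot_alg (Lc R X) J) (Lc R (subtopology X F))"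
proof -
  interpret cring R by fact
  have J: "additive_subgroup J (Lc R X)" using assms(4) by (simp add: ring_ideal_def)
  have clF: "closedin X F"
    unfolding assms(5) using additive_subgroup.a_subset[OF J] by (rule closedin_common_zeros)
  then have FX: "F \<subseteq> topspace X" by (rule closedin_subset)
  then have top: "topspace X \<inter> F = F" by auto
  note restr = Lc_restrict_closed[OF _ clF]
  show ?thesis
  proof (rule alg_isomorphic_quot_alg[where p = "\<lambda>f. restrict f F"])
    show "(\<lambda>f. restrict f F) ` carrier (Lc R X) = carrier (Lc R (subtopology X F))"
    proof (intro equalityI subsetI)
      fix h assume h: "h \<in> carrier (Lc R (subtopology X F))"
      then obtain f where f: "f \<in> carrier (Lc R X)" "\<And>x. x \<in> F \<Longrightarrow> f x = h x"
        using Lc_restrict_surj[OF ring_axioms assms(3) FX] by blast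
      have "h = restrict f F"
        using f(2) by (intro Lc_eqI[OF h restr[OF f(1)]]) simp
      with f(1) show "h \<in> (\<lambda>f. restrict f F) ` carrier (Lc R X)" by blast
    qed (auto simp: restr)
    \<comment> \<open>Both \<open>restrict f F\<close> and the zero of the target are
      \<open>undefined\<close> outside \<open>F\<close>, so they agree as functions exactly when
      \<open>f\<close> vanishes on \<open>F\<close>.\<close>
    show "f \<in> J \<longleftrightarrow> restrict f F = \<zero>\<^bsub>Lc R (subtopology X F)\<^esub>" if "f \<in> carrier (Lc R X)" for f
      using Lc_ideal_mem_iff[OF assms(1,4,5,6) that]
      by (auto simp: Lc_simps top fun_eq_iff)
  \<comment> \<open>What remains is the group structure, closure under the operations, and the fact
    that restriction commutes with operations defined pointwise.\<close>
  qed (use FX in \<open>auto simp: Lc_simps(1-3) top J abelian_group_Lc[OF ring_axioms]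
        Lc_closed[OF ring_axioms, unfolded Lc_simps] intro!: restrict_ext\<close>)
qed

end
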